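(* Let $\mathcal{H}\subseteq 2^{[n]}\setminus\{\emptyset\}$ be a minimally transversal-free hypergraph. Then in the game $\mathrm{NIM}_{\mathcal{H}}$, for all $k\in\mathbb{Z}_+$: $\mathcal{R}(x)=2k$ if $x\in P(k)$, and $\mathcal{R}(x)=2k+1$ if $x\in N(k)$.
   Context: Hypergraph NIM $\mathrm{NIM}_{\mathcal{H}}$: positions are $x\in\mathbb{Z}_+^n$; $x\to x'$ is a move iff $x\ge x'$ componentwise and $\{i: x'_i<x_i\}\in\mathcal{H}$; a player unable to move loses. For a hypergraph $\mathcal{F}$, $\mathcal{F}^t=\{T\subseteq[n]: T\cap F\neq\emptyset\ \forall F\in\mathcal{F}\}$. For $S\subseteq[n]$, $\mathcal{H}_S=\{H\in\mathcal{H}: H\subseteq S\}$. $\mathcal{H}$ is minimally transversal-free (MTF) if $\mathcal{H}\cap\mathcal{H}^t=\emptyset$ and for every nonempty proper subset $S\subsetneq[n]$ there is $H\in\mathcal{H}_S$ with $H\in(\mathcal{H}_S)^t$. For a position $x$: $m(x)=\min_i x_i$, $M(x)=\{i: x_i=m(x)\}$. For $k\in\mathbb{Z}_+$: $P(k)=\{x: m(x)=k,\ M(x)\in\mathcal{H}^t\}$ and $N(k)=\{x: \text{there is a move } x\to x' \text{ with } x'\in P(k)\}$. Remoteness function: $\mathcal{R}(x)=0$ if $x$ is terminal; otherwise, if some move $x\to y$ has $\mathcal{R}(y)$ even, $\mathcal{R}(x)=1+\min\{\mathcal{R}(y): x\to y,\ \mathcal{R}(y)\text{ even}\}$, else $\mathcal{R}(x)=1+\max\{\mathcal{R}(y):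 x\to y\}$.
   Formalization: The hypergraph is additionally assumed nonempty: for n = 1 the empty hypergraph is vacuously minimally transversal-free and every position is terminal, so the position (1) lies in P(1) but has remoteness 0 instead of 2; for n ≥ 2 nonemptiness is automatic. *)

theory Defs
  imports Main "HOL-Library.FuncSet"
begin

(* The ground set [n] is {1..n}; hypergraphs on [n] are subsets of Pow {1..n}. *)

definition transversals :: "nat \<Rightarrow> nat set set \<Rightarrow> nat set set" where
  "transversals n F = {T. T \<subseteq> {1..n} \<and> (\<forall>A\<in>F. T \<inter> A \<noteq> {})}"

definition induced :: "nat set set \<Rightarrow> nat set \<Rightarrow> nat set set" where
  "induced H S = {A \<in> H. A \<subseteq> S}"

(* Pitfall: for n = 1 the empty hypergraph satisfies this definition vacuously. *)
definition minimally_transversal_free :: "nat \<Rightarrow> nat set set \<Rightarrow> bool" where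
  "minimally_transversal_free n H \<longleftrightarrow>
     H \<inter> transversals n H = {} \<and>
     (\<forall>S. S \<noteq> {} \<and> S \<subset> {1..n} \<longrightarrow>
        (\<exists>A \<in> induced H S. A \<in> transversals n (induced H S)))"

(* Extensional functions, so that each vector in Z_+^n has exactly one representative. *)
definition positions :: "nat \<Rightarrow> (nat \<Rightarrow> nat) set" where
  "positions n = {1..n} \<rightarrow>\<^sub>E UNIV"

definition nim_move :: "nat \<Rightarrow> nat set set \<Rightarrow> (nat \<Rightarrow> nat) \<Rightarrow> (nat \<Rightarrow> nat) \<Rightarrow> bool" where
  "nim_move n H x y \<longleftrightarrow>
     x \<in> positions n \<and> y \<in> positions n \<and>
     (\<forall>i\<in>{1..n}. y i \<le> x i) \<and> {i \<in> {1..n}. y i < x i} \<in> H"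

definition min_entry :: "nat \<Rightarrow> (nat \<Rightarrow> nat) \<Rightarrow> nat" where
  "min_entry n x = Min (x ` {1..n})"

definition min_set :: "nat \<Rightarrow> (nat \<Rightarrow> nat) \<Rightarrow> nat set" where
  "min_set n x = {i \<in> {1..n}. x i = min_entry n x}"

definition P_positions :: "nat \<Rightarrow> nat set set \<Rightarrow> nat \<Rightarrow> (nat \<Rightarrow> nat) set" where
  "P_positions n H k =
     {x \<in> positions n. min_entry n x = k \<and> min_set n x \<in> transversals n H}"

definition N_positions :: "nat \<Rightarrow> nat set set \<Rightarrow> nat \<Rightarrow> (nat \<Rightarrow> nat) set" where
  "N_positions n H k =
     {x \<in> positions n. \<exists>y. nim_move n H x y \<and> y \<in> P_positions n H k}"

(* Remoteness for an arbitrary move relation. The recursion is meaningful when the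
   relation is terminating and finitely branching (see remoteness_unfold and
   finite_nim_moves); elsewhere the value is unspecified. *)
function (domintros) remoteness :: "('p \<Rightarrow> 'p \<Rightarrow> bool) \<Rightarrow> 'p \<Rightarrow> nat" where
  "remoteness mv x =
     (let V = remoteness mv ` {y. mv x y} in
      if {y. mv x y} = {} then 0
      else if \<exists>v\<in>V. even v then 1 + Min {v \<in> V. even v}
      else 1 + Max V)"
  by pat_completeness auto

lemma remoteness_dom_if_wf:
  assumes "wfP (\<lambda>y x. mv x y)"
  shows "remoteness_dom (mv, x)"
  using assms
proof (induction x rule: wfp_induct_rule)
  case (less x)
  then show ?case by (auto intro: remoteness.domintros)
qed

lemma remoteness_unfold:
  assumes "wfP (\<lambda>y x. mv x y)"
  shows "remoteness mv x =
    (if \<nexists>y. mv x y then 0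
     else if \<exists>y. mv x y \<and> even (remoteness mv y)
       then 1 + Min {remoteness mv y |y. mv x y \<and> even (remoteness mv y)}
     else 1 + Max {remoteness mv y |y. mv x y})"
proof -
  have 1: "{v \<in> remoteness mv ` {y. mv x y}. even v}
      = {remoteness mv y |y. mv x y \<and> even (remoteness mv y)}" by auto
  have 2: "remoteness mv ` {y. mv x y} = {remoteness mv y |y. mv x y}" by auto
  show ?thesis
    unfolding remoteness.psimps[OF remoteness_dom_if_wf[OF assms], of x] Let_def 1
    unfolding 2 by auto
qed

lemma nim_move_wf:
  assumes "{} \<notin> H"
  shows "wfP (\<lambda>y x. nim_move n H x y)"
proof (rule wfp_if_convertible_to_nat[where f = "\<lambda>x. \<Sum>i\<in>{1..n}. x i"])
  fix y x assume mv: "nim_move n H x y"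
  then have "{i \<in> {1..n}. y i < x i} \<noteq> {}"
    using assms unfolding nim_move_def by metis
  then show "(\<Sum>i\<in>{1..n}. y i) < (\<Sum>i\<in>{1..n}. x i)"
    using mv unfolding nim_move_def by (intro sum_strict_mono_ex1) auto
qed

lemma finite_nim_moves: "finite {y. nim_move n H x y}"
proof (rule finite_subset)
  show "{y. nim_move n H x y} \<subseteq> (\<Pi>\<^sub>E i\<in>{1..n}. {..x i})"
    by (auto simp: nim_move_def positions_def PiE_def extensional_def)
qed (simp add: finite_PiE)

end

(* Write m for the minimum entry and M for the set of its positions. If a move lowers m and
   leaves M transversal, then the move has changed all of M, so the edge played is itself
   transversal, which is excluded. Hence positions with M transversal can only be reached
   without changing m. If M is not transversal, some edge avoids M; minimality applied to the
   complement of M yields an edge which, once all its entries are lowered to m, makes M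
   transversal. If M is transversal, every move lowers m, and m - 1 can be reached by lowering
   the entries of any edge to m - 1. The value 2m or 2m + 1 of the remoteness follows by
   well-founded induction. *)

theory Submission
  imports Defs
begin

lemma min_entry_le:
  assumes "i \<in> {1..n}"
  shows "min_entry n x \<le> x i"
  using assms by (simp add: min_entry_def)

lemma min_set_nonempty:
  assumes "n > 0"
  shows "min_set n x \<noteq> {}"
proof -
  have "Min (x ` {1..n}) \<in> x ` {1..n}"
    using assms by (intro Min_in) auto
  then show ?thesis by (auto simp: min_set_def min_entry_def)
qed

lemma min_entry_eqI:
  assumes "i \<in> {1..n}" "x i = c" "\<And>j. j \<in> {1..n} \<Longrightarrow> c \<le> x j"
  shows "min_entry n x = c"
  unfolding min_entry_def using assms by (intro Min_eqI) auto

lemma min_entry_move_le: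
  assumes "n > 0" "nim_move n H x y"
  shows "min_entry n y \<le> min_entry n x"
proof -
  obtain i where "i \<in> {1..n}" "x i = min_entry n x"
    using min_set_nonempty[OF assms(1)] by (auto simp: min_set_def)
  then show ?thesis
    using assms(2) min_entry_le[of i n y] by (force simp: nim_move_def)
qed

lemma transversals_mono:
  assumes "T \<in> transversals n F" "T \<subseteq> U" "U \<subseteq> {1..n}"
  shows "U \<in> transversals n F"
  using assms by (fastforce simp: transversals_def)

text \<open>Both moves constructed later send all entries of an edge to one common level: the
  current minimum, or the value just below it.\<close>

definition lower_to :: "nat set \<Rightarrow> nat \<Rightarrow> (nat \<Rightarrow> nat) \<Rightarrow> nat \<Rightarrow> nat" where
  "lower_to A c x = (\<lambda>i. if i \<in> A then c else x i)"

lemma nim_move_lower_to: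
  assumes "x \<in> positions n" "A \<in> H" "A \<subseteq> {1..n}" "\<And>i. i \<in> A \<Longrightarrow> c < x i"
  shows "nim_move n H x (lower_to A c x)"
proof -
  have "lower_to A c x \<in> positions n"
    using assms(1,3) by (auto simp: positions_def lower_to_def PiE_def extensional_def)
  moreover have "{i \<in> {1..n}. lower_to A c x i < x i} = A"
    using assms(3,4) by (auto simp: lower_to_def)
  moreover have "\<forall>i\<in>{1..n}. lower_to A c x i \<le> x i"
    using assms(4) by (auto simp: lower_to_def intro: less_imp_le)
  ultimately show ?thesis
    using assms(1,2) by (simp add: nim_move_def)
qed

lemma min_entry_lower_to:
  assumes "A \<subseteq> {1..n}" "A \<noteq> {}" "c \<le> min_entry n x"
  shows "min_entry n (lower_to A c x) = c"
proof -
  obtain i where "i \<in> A" using assms(2) by blast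
  then show ?thesis
    using assms order_trans[OF assms(3) min_entry_le]
    by (intro min_entry_eqI[of i]) (auto simp: lower_to_def)
qed

lemma transversal_min_set_move_same_min:
  assumes "n > 0" "H \<inter> transversals n H = {}" "nim_move n H x y"
    and "min_set n y \<in> transversals n H"
  shows "min_entry n y = min_entry n x"
proof (rule ccontr)
  assume "min_entry n y \<noteq> min_entry n x"
  then have less: "min_entry n y < min_entry n x"
    using min_entry_move_le[OF assms(1,3)] by simp
  let ?A = "{i \<in> {1..n}. y i < x i}"
  \<comment> \<open>An index attaining the new minimum lies strictly below the old minimum, hence
    below its own old entry.\<close>
  have "min_set n y \<subseteq> ?A"
    using less_le_trans[OF less min_entry_le] by (auto simp: min_set_def)
  then have "?A \<in> transversals n H"
    by (rule transversals_mono[OF assms(4)]) auto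
  then show False
    using assms(2,3) by (auto simp: nim_move_def)
qed

text \<open>A transversal meets the edge played, so some entry equal to the minimum drops.\<close>

lemma move_from_transversal_min_set_less:
  assumes "min_set n x \<in> transversals n H" "nim_move n H x y"
  shows "min_entry n y < min_entry n x"
proof -
  have "min_set n x \<inter> {i \<in> {1..n}. y i < x i} \<noteq> {}"
    using assms by (auto simp: transversals_def nim_move_def)
  then obtain i where "i \<in> {1..n}" "x i = min_entry n x" "y i < x i"
    unfolding min_set_def by blast
  then show ?thesis
    using min_entry_le[of i n y] by simp
qed

lemma ex_move_to_transversal_min_set:
  assumes "n > 0" "H \<subseteq> Pow {1..n} - {{}}" "minimally_transversal_free n H"
    and "x \<in> positions n" "min_set n x \<notin> transversals n H"
  obtains y where "nim_move n H x y" "min_set n y \<in> transversals n H"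
proof -
  let ?S = "{1..n} - min_set n x" and ?m = "min_entry n x"
  have sub: "min_set n x \<subseteq> {1..n}" by (auto simp: min_set_def)
  with assms(5) obtain B where "B \<in> H" "min_set n x \<inter> B = {}"
    by (auto simp: transversals_def)
  moreover have "B \<subseteq> {1..n}" "B \<noteq> {}" using \<open>B \<in> H\<close> assms(2) by auto
  \<comment> \<open>The missed edge \<open>B\<close> lies in the complement, and the minimum is
    attained; so the complement is nonempty and proper, as minimality requires.\<close>
  ultimately have "?S \<noteq> {}" by blast
  moreover have "?S \<subset> {1..n}"
    using sub min_set_nonempty[OF assms(1), of x] by blast
  ultimately have "\<exists>A \<in> induced H ?S. A \<in> transversals n (induced H ?S)"
    using assms(3) by (simp add: minimally_transversal_free_def)
  then obtain A where A: "A \<in> induced H ?S" "A \<in> transversals n (induced H ?S)" by blast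
  have AH: "A \<in> H" "A \<subseteq> ?S" using A(1) by (auto simp: induced_def)
  have An: "A \<subseteq> {1..n}" "A \<noteq> {}" using AH assms(2) by auto
  let ?y = "lower_to A ?m x"
  have "?m < x i" if "i \<in> A" for i
    using that AH(2) min_entry_le[of i n x] by (force simp: min_set_def)
  then have mv: "nim_move n H x ?y"
    by (intro nim_move_lower_to assms(4) AH(1) An(1))
  have "min_set n ?y = min_set n x \<union> A"
    using An(1) min_entry_lower_to[OF An, of ?m x] by (auto simp: min_set_def lower_to_def)
  \<comment> \<open>An edge inside the complement is met by \<open>A\<close>; any other edge meets
    the minimum set itself.\<close>
  moreover have "(min_set n x \<union> A) \<inter> B \<noteq> {}" if "B \<in> H" for B
  proof (cases "B \<subseteq> ?S")
    case True
    then show ?thesis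
      using A(2) that by (auto simp: transversals_def induced_def)
  next
    case False
    then show ?thesis using that assms(2) by blast
  qed
  ultimately have "min_set n ?y \<in> transversals n H"
    using sub An(1) by (simp add: transversals_def)
  with mv show thesis by (rule that)
qed

text \<open>The induction needs a value at every successor, so the formula covers all positions at
  once. An edge in \<open>H\<close> forces \<open>n > 0\<close> and later supplies a move.\<close>

lemma remoteness_nim:
  assumes "H \<subseteq> Pow {1..n} - {{}}" "H \<noteq> {}" "minimally_transversal_free n H"
    and "x \<in> positions n"
  shows "remoteness (nim_move n H) x =
    (if min_set n x \<in> transversals n H then 2 * min_entry n x else 2 * min_entry n x + 1)"
proof -
  have n: "n > 0" using assms(1,2) by (cases n) auto
  have free: "H \<inter> transversals n H = {}"
    using assms(3) by (simp add: minimally_transversal_free_def)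
  have wf: "wfP (\<lambda>y x. nim_move n H x y)"
    using assms(1) by (intro nim_move_wf) auto
  let ?R = "remoteness (nim_move n H)"
  show ?thesis
    using wf assms(4)
  proof (induction x rule: wfp_induct_rule)
    case (less x)
    have IH: "?R y = (if min_set n y \<in> transversals n H
        then 2 * min_entry n y else 2 * min_entry n y + 1)" if "nim_move n H x y" for y
    proof -
      have "y \<in> positions n" using that by (simp add: nim_move_def)
      then show ?thesis using less.IH[OF that] by blast
    qed
    note unfold = remoteness_unfold[OF wf, of x]
    show ?case
    proof (cases "min_set n x \<in> transversals n H")
      case True
      \<comment> \<open>A successor with transversal minimum set would keep the minimum, yet here
        every move lowers it; so all successors have odd remoteness.\<close>
      have R: "?R y = 2 * min_entry n y + 1" "min_entry n y < min_entry n x"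
        if "nim_move n H x y" for y
      proof -
        show lt: "min_entry n y < min_entry n x"
          using move_from_transversal_min_set_less[OF True that] .
        show "?R y = 2 * min_entry n y + 1"
          using IH[OF that] transversal_min_set_move_same_min[OF n free that] lt by auto
      qed
      show ?thesis
      proof (cases "min_entry n x = 0")
        case zero: True
        then have "\<nexists>y. nim_move n H x y" using R(2) by fastforce
        then show ?thesis using unfold True zero by simp
      next
        case False
        obtain A where A: "A \<in> H" "A \<subseteq> {1..n}" "A \<noteq> {}" using assms(1,2) by blast
        \<comment> \<open>The minimum is positive, so the truncated subtraction is exact, and this
          move attains the largest odd value that \<open>R\<close> allows.\<close>
        let ?y = "lower_to A (min_entry n x - 1) x"
        have "min_entry n x - 1 < x i" if "i \<in> A" for i
          using False that A(2) min_entry_le[of i n x] by fastforce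
        then have mv: "nim_move n H x ?y"
          by (intro nim_move_lower_to less.prems A)
        have Ry: "?R ?y = 2 * min_entry n x - 1"
          using R(1)[OF mv] min_entry_lower_to[OF A(2,3)] False by simp
        have "finite {?R y |y. nim_move n H x y}"
          using finite_nim_moves[of n H x] by simp
        then have "Max {?R y |y. nim_move n H x y} = 2 * min_entry n x - 1"
        proof (rule Max_eqI)
          show "r \<le> 2 * min_entry n x - 1" if "r \<in> {?R y |y. nim_move n H x y}" for r
          proof -
            obtain y where "r = ?R y" "nim_move n H x y" using \<open>r \<in> _\<close> by blast
            then show ?thesis using R[of y] by simp
          qed
          show "2 * min_entry n x - 1 \<in> {?R y |y. nim_move n H x y}"
            using mv Ry[symmetric] by blast
        qed
        \<comment> \<open>Only odd values occur, which selects the \<open>Max\<close> clause of the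
          recursion.\<close>
        moreover have "\<nexists>y. nim_move n H x y \<and> even (?R y)" using R(1) by auto
        moreover have "?R x = 1 + Max {?R y |y. nim_move n H x y}"
          using calculation(2) mv by (subst unfold) meson
        ultimately show ?thesis
          using True False by simp
      qed
    next
      case False
      \<comment> \<open>An even value marks a successor with transversal minimum set, and such a
        successor keeps the minimum; so the \<open>Min\<close> below ranges over a
        singleton.\<close>
      have R: "?R y = 2 * min_entry n x" if "nim_move n H x y" "even (?R y)" for y
        using IH[OF that(1)] that transversal_min_set_move_same_min[OF n free that(1)]
        by (auto split: if_splits)
      obtain z where z: "nim_move n H x z" "min_set n z \<in> transversals n H"
        using ex_move_to_transversal_min_set[OF n assms(1,3) less.prems False] .
      have "even (?R z)" using IH[OF z(1)] z(2) by simp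
      then have "{?R y |y. nim_move n H x y \<and> even (?R y)} = {2 * min_entry n x}"
        using R[symmetric] z(1) R by blast
      moreover have "?R x = 1 + Min {?R y |y. nim_move n H x y \<and> even (?R y)}"
        using \<open>even (?R z)\<close> z(1) by (subst unfold) meson
      ultimately show ?thesis
        using False by simp
    qed
  qed
qed

theorem mainTheorem8:
  fixes n :: nat and H :: "nat set set"
  assumes "H \<subseteq> Pow {1..n} - {{}}"
    and "H \<noteq> {}"
    and "minimally_transversal_free n H"
  shows "\<forall>k x. (x \<in> P_positions n H k \<longrightarrow> remoteness (nim_move n H) x = 2 * k) \<and>
               (x \<in> N_positions n H k \<longrightarrow> remoteness (nim_move n H) x = 2 * k + 1)"
proof (intro allI conjI impI)
  fix k x
  assume "x \<in> P_positions n H k"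
  then show "remoteness (nim_move n H) x = 2 * k"
    using remoteness_nim[OF assms, of x] by (simp add: P_positions_def)
next
  fix k x
  assume "x \<in> N_positions n H k"
  then obtain y where x: "x \<in> positions n" and y: "nim_move n H x y"
      "min_entry n y = k" "min_set n y \<in> transversals n H"
    by (auto simp: N_positions_def P_positions_def)
  have "n > 0" using assms(1,2) by (cases n) auto
  moreover have "H \<inter> transversals n H = {}"
    using assms(3) by (simp add: minimally_transversal_free_def)
  \<comment> \<open>The move into \<open>P_positions n H k\<close> keeps the minimum; from a
    transversal minimum set it would have lowered it, so the odd case of the formula
    applies.\<close>
  ultimately have k: "min_entry n x = k"
    using transversal_min_set_move_same_min[OF _ _ y(1,3)] y(2) by simp
  have "min_set n x \<notin> transversals n H"
    using move_from_transversal_min_set_less[OF _ y(1)] y(2) k by auto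
  then show "remoteness (nim_move n H) x = 2 * k + 1"
    using remoteness_nim[OF assms x] k by simp
qed

end
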